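(* As $n\to\infty$, $$\mathrm{H}=\log\log n\,(1+o(1)),\qquad \sigma^2=O(\log\log n).$$
   Context: Model. For each integer $n\ge 2$ let $[n]=\{1,\dots,n\}$ and let $(w_x^+)_{x\in[n]}$, $(w_x^-)_{x\in[n]}$ be positive weights (allowed to depend on $n$) with $\sum_{x}w_x^+=\sum_x w_x^-=:\boldsymbol{w}$. The Chung–Lu digraph $G$ on $[n]$ has each oriented edge $x\to y$, $x\ne y$, present independently with probability $p_{xy}=\big(w_x^+w_y^-\frac{\log n}{n}\big)\wedge 1$ (no self-loops). Its law is $\mathbb{P}$ with expectation $\mathbb{E}$. Assumptions on the weights: there are constants $M_0,M_1>1$, $M_2>0$, $0<\eta<1$, independent of $n$, such that for every $n$: $M_0\le w_x^+\le M_1$ for all $x\in[n]$, and $\sum_{x\in[n]}(w_x^-)^{2+\eta}\le M_2 n$. $D_x^+$ denotes the out-degree of $x$. Let $\mu_{\mathrm{in}}(x):=w_x^-/\boldsymbol{w}$ for $x\in[n]$, and let $V$ be a random vertex with law $\mu_{\mathrm{in}}$, independent of $G$. Set $\mathrm{H}:=(\mathbb{E}\times\mu_{\mathrm{in}})[\log(D_V^+\vee 1)]=\sum_x\mu_{\mathrm{in}}(x)\,\mathbb{E}[\log(D_x^+\vee 1)]$ and $\sigma^2:=(\mathbb{E}\times\mu_{\mathrm{in}})[\log^2(D_V^+\vee 1)]-\mathrm{H}^2$. *)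

theory Defs
  imports
    "HOL-Probability.Probability"
    "HOL-Library.Landau_Symbols"
    "Graph_Theory.Digraph"
    "Graph_Theory.Pair_Digraph"
begin

text \<open>
  Throughout, \<open>wp x\<close> and \<open>wm x\<close> stand for the weights $w_x^+$ and $w_x^-$ of the vertex
  \<open>x \<in> {1..n}\<close>; their values outside \<open>{1..n}\<close> are never used.
\<close>

definition chung_lu_weights :: "nat \<Rightarrow> (nat \<Rightarrow> real) \<Rightarrow> (nat \<Rightarrow> real) \<Rightarrow> bool" where
  "chung_lu_weights n wp wm \<longleftrightarrow>
     (\<forall>x\<in>{1..n}. 0 < wp x) \<and> (\<forall>x\<in>{1..n}. 0 < wm x) \<and>
     (\<Sum>x\<in>{1..n}. wp x) = (\<Sum>x\<in>{1..n}. wm x)"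

definition edge_prob :: "nat \<Rightarrow> (nat \<Rightarrow> real) \<Rightarrow> (nat \<Rightarrow> real) \<Rightarrow> nat \<Rightarrow> nat \<Rightarrow> real" where
  "edge_prob n wp wm x y = min (wp x * wm y * (ln (real n) / real n)) 1"

definition possible_edges :: "nat \<Rightarrow> (nat \<times> nat) set" where
  "possible_edges n = {(x, y). x \<in> {1..n} \<and> y \<in> {1..n} \<and> x \<noteq> y}"

text \<open>
  The law of the digraph: the indicators of the possible edges are independent Bernoulli
  variables (\<open>False\<close> is merely the default value of \<open>Pi_pmf\<close> off the index set).
\<close>

definition chung_lu_digraph ::
    "nat \<Rightarrow> (nat \<Rightarrow> real) \<Rightarrow> (nat \<Rightarrow> real) \<Rightarrow> nat pair_pre_digraph pmf" where
  "chung_lu_digraph n wp wm =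
     map_pmf (\<lambda>present. \<lparr>pverts = {1..n}, parcs = {e \<in> possible_edges n. present e}\<rparr>)
       (Pi_pmf (possible_edges n) False
          (\<lambda>(x, y). bernoulli_pmf (edge_prob n wp wm x y)))"

text \<open>
  The total weight is taken to be the sum of the $w_x^-$, which agrees with the sum of the
  $w_x^+$ under \<open>chung_lu_weights\<close>.
\<close>

definition mu_in :: "nat \<Rightarrow> (nat \<Rightarrow> real) \<Rightarrow> nat pmf" where
  "mu_in n wm = embed_pmf (\<lambda>x. if x \<in> {1..n} then wm x / (\<Sum>z\<in>{1..n}. wm z) else 0)"

text \<open>\<open>embed_pmf\<close> is only meaningful for a genuine mass function; this is the case here.\<close>

lemma pmf_mu_in:
  assumes "n \<ge> 1" and "\<And>x. x \<in> {1..n} \<Longrightarrow> 0 < wm x"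
  shows "pmf (mu_in n wm) x = (if x \<in> {1..n} then wm x / (\<Sum>z\<in>{1..n}. wm z) else 0)"
proof -
  let ?f = "\<lambda>x. if x \<in> {1..n} then wm x / (\<Sum>z\<in>{1..n}. wm z) else 0"
  have pos: "(\<Sum>z\<in>{1..n}. wm z) > 0"
    using assms by (intro sum_pos) auto
  have nonneg: "0 \<le> ?f x" for x
    using assms(2)[of x] pos by auto
  have "(\<integral>\<^sup>+x. ennreal (?f x) \<partial>count_space UNIV) = (\<Sum>x\<in>{1..n}. ennreal (?f x))"
    by (intro nn_integral_count_space'[of "{1..n}"]) auto
  also have "\<dots> = ennreal (\<Sum>x\<in>{1..n}. ?f x)"
    by (intro sum_ennreal nonneg)
  also have "(\<Sum>x\<in>{1..n}. ?f x) = 1"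
    using pos by (simp add: sum_divide_distrib[symmetric])
  finally have "(\<integral>\<^sup>+x. ennreal (?f x) \<partial>count_space UNIV) = 1"
    by simp
  then show ?thesis
    unfolding mu_in_def using nonneg by (intro pmf_embed_pmf)
qed

text \<open>
  The expectation under the product of the law of the digraph and \<open>mu_in\<close>, i.e. the digraph
  and the random vertex are independent.
\<close>

definition joint_expectation ::
    "nat \<Rightarrow> (nat \<Rightarrow> real) \<Rightarrow> (nat \<Rightarrow> real) \<Rightarrow> (nat pair_pre_digraph \<Rightarrow> nat \<Rightarrow> real) \<Rightarrow> real" where
  "joint_expectation n wp wm f =
     measure_pmf.expectation (pair_pmf (chung_lu_digraph n wp wm) (mu_in n wm)) (\<lambda>(G, v). f G v)"

definition log_out_degree :: "nat pair_pre_digraph \<Rightarrow> nat \<Rightarrow> real" where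
  "log_out_degree G v = ln (real (max (out_degree (with_proj G) v) 1))"

definition entropy_H :: "nat \<Rightarrow> (nat \<Rightarrow> real) \<Rightarrow> (nat \<Rightarrow> real) \<Rightarrow> real" where
  "entropy_H n wp wm = joint_expectation n wp wm log_out_degree"

definition sigma_sq :: "nat \<Rightarrow> (nat \<Rightarrow> real) \<Rightarrow> (nat \<Rightarrow> real) \<Rightarrow> real" where
  "sigma_sq n wp wm =
     joint_expectation n wp wm (\<lambda>G v. (log_out_degree G v)\<^sup>2) - (entropy_H n wp wm)\<^sup>2"

end

theory Submission
  imports Defs "HOL-Real_Asymp.Real_Asymp"
begin

text \<open>
  Put $l = \log n$. The bounds on the weights make every mean out-degree of order $l$ (for the lower
  bound, truncating the edge probabilities at $1$ costs at most the sum of their squares, which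
  is $O(l^2/n)$), and the variance of a sum of independent indicators is at most its mean.
  Hence $(\log(D_v^+ \vee 1) - \log l)^2$ has expectation $O(1)$ uniformly in $v$, so that
  even $\mathrm{H} = \log\log n + O(1)$ and $\sigma^2 = O(1)$.
\<close>

section \<open>Finitely supported product laws and sums of independent indicators\<close>

text \<open>By independence the joint expectation is an average over \<open>v\<close> of
  expectations under \<open>P\<close> alone, so a bound uniform in the vertex passes to the joint
  law.\<close>

lemma expectation_pair_pmf_le:
  fixes f :: "'a \<Rightarrow> 'b \<Rightarrow> real"
  assumes "finite (set_pmf P)" "finite (set_pmf Q)"
    and le: "\<And>v. v \<in> set_pmf Q \<Longrightarrow> measure_pmf.expectation P (\<lambda>x. f x v) \<le> K"
  shows "measure_pmf.expectation (pair_pmf P Q) (\<lambda>(x, v). f x v) \<le> K"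
proof -
  \<comment> \<open>The coordinates are swapped so that \<open>v\<close> is drawn first and the bind
    expands over \<open>set_pmf Q\<close>.\<close>
  have "measure_pmf.expectation (pair_pmf P Q) (\<lambda>(x, v). f x v)
      = measure_pmf.expectation (pair_pmf Q P) (\<lambda>(v, x). f x v)"
    by (subst pair_commute_pmf) (simp add: case_prod_unfold)
  also have "\<dots> = (\<Sum>v\<in>set_pmf Q. pmf Q v * measure_pmf.expectation P (\<lambda>x. f x v))"
    unfolding pair_pmf_def using assms(1,2)
    by (subst pmf_expectation_bind[where A = "set_pmf Q"])
       (auto simp: map_pmf_def[symmetric])
  also have "\<dots> \<le> (\<Sum>v\<in>set_pmf Q. pmf Q v * K)"
    by (intro sum_mono mult_left_mono le) auto
  also have "\<dots> = K"
    using assms(2) by (simp add: sum_distrib_right[symmetric] sum_pmf_eq_1)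
  finally show ?thesis .
qed

text \<open>Makes every real function integrable under the law of the edge indicators; all later
  integrability conditions reduce to finite support.\<close>

lemma finite_set_Pi_bool_pmf:
  fixes q :: "'a \<Rightarrow> bool pmf"
  assumes "finite A"
  shows "finite (set_pmf (Pi_pmf A d q))"
  using set_Pi_pmf_subset'[OF assms] finite_PiE_dflt[OF assms, of _ d]
  by (rule finite_subset) auto

text \<open>Independence makes the centred indicators pairwise orthogonal, so only the diagonal
  terms \<open>p i * (1 - p i)\<close> of the expanded square survive, and each is at most
  \<open>p i\<close>.\<close>

lemma
  fixes p :: "'a \<Rightarrow> real"
  assumes A: "finite A" "S \<subseteq> A" and p: "\<And>e. e \<in> A \<Longrightarrow> 0 \<le> p e \<and> p e \<le> 1"
  defines "P \<equiv> Pi_pmf A False (\<lambda>e. bernoulli_pmf (p e))"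
  shows expectation_card_Pi_bernoulli:
      "measure_pmf.expectation P (\<lambda>f. real (card {e \<in> S. f e})) = (\<Sum>e\<in>S. p e)"
    and variance_card_Pi_bernoulli_le:
      "measure_pmf.expectation P (\<lambda>f. (real (card {e \<in> S. f e}) - (\<Sum>e\<in>S. p e))\<^sup>2) \<le> (\<Sum>e\<in>S. p e)"
proof -
  have fin: "finite (set_pmf P)"
    unfolding P_def by (intro finite_set_Pi_bool_pmf A)
  note int [simp] = integrable_measure_pmf_finite[OF fin]
  have finS: "finite S" using A finite_subset by blast
  have card: "real (card {e \<in> S. f e}) = (\<Sum>e\<in>S. of_bool (f e))" for f
    using finS by (simp add: Int_def)
  have single: "measure_pmf.expectation P (\<lambda>f. h (f e)) = h True * p e + h False * (1 - p e)"
    if "e \<in> A" for e and h :: "bool \<Rightarrow> real"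
  proof -
    have "measure_pmf.expectation P (\<lambda>f. h (f e)) = measure_pmf.expectation (map_pmf (\<lambda>f. f e) P) h"
      by simp
    then show ?thesis
      unfolding P_def using that p[of e] A by (subst (asm) Pi_pmf_component) auto
  qed
  show "measure_pmf.expectation P (\<lambda>f. real (card {e \<in> S. f e})) = (\<Sum>e\<in>S. p e)"
    unfolding card using A by (subst Bochner_Integration.integral_sum) (auto simp: single intro!: sum.cong)
  define c where "c = (\<lambda>e b. of_bool b - p e)"
  have orth: "measure_pmf.expectation P (\<lambda>f. c i (f i) * c j (f j)) = 0"
    if "i \<in> S" "j \<in> S" "i \<noteq> j" for i j
  proof -
    have ij: "i \<in> A" "j \<in> A" using A that by auto
    \<comment> \<open>The factor is \<open>1\<close> off \<open>{i, j}\<close>: this writes a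
      product of two indicators as a product over all of \<open>A\<close>, the form in which
      independence factors the expectation.\<close>
    let ?g = "\<lambda>e b. if e \<in> {i, j} then of_bool b else 1 :: real"
    have split: "(\<Prod>e\<in>A. if e \<in> {i, j} then h e else 1) = h i * h j" for h :: "'a \<Rightarrow> real"
    proof -
      have "(\<Prod>e\<in>A. if e \<in> {i, j} then h e else 1) = (\<Prod>e\<in>{i, j}. h e)"
        using A ij by (intro prod.mono_neutral_cong_right) auto
      then show ?thesis using that by simp
    qed
    have "measure_pmf.expectation P (\<lambda>f. of_bool (f i) * of_bool (f j))
        = measure_pmf.expectation P (\<lambda>f. \<Prod>e\<in>A. ?g e (f e))"
      by (simp only: split)
    also have "\<dots> = (\<Prod>e\<in>A. measure_pmf.expectation (bernoulli_pmf (p e)) (?g e))"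
      unfolding P_def
      by (subst expectation_prod_Pi_pmf)
         (use A in \<open>auto intro: integrable_measure_pmf_finite\<close>)
    also have "\<dots> = (\<Prod>e\<in>A. if e \<in> {i, j} then p e else 1)"
      using p by (intro prod.cong) auto
    also have "\<dots> = p i * p j"
      by (rule split)
    finally have "measure_pmf.expectation P (\<lambda>f. of_bool (f i) * of_bool (f j)) = p i * p j" .
    moreover have "(\<lambda>f. c i (f i) * c j (f j)) = (\<lambda>f. of_bool (f i) * of_bool (f j)
        - p j * of_bool (f i) - p i * of_bool (f j) + p i * p j)"
      by (simp add: c_def algebra_simps)
    ultimately show ?thesis
      using single[OF ij(1), of of_bool] single[OF ij(2), of of_bool] by simp
  qed
  have "measure_pmf.expectation P (\<lambda>f. (real (card {e \<in> S. f e}) - (\<Sum>e\<in>S. p e))\<^sup>2)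
      = measure_pmf.expectation P (\<lambda>f. \<Sum>i\<in>S. \<Sum>j\<in>S. c i (f i) * c j (f j))"
    unfolding card c_def sum_subtractf[symmetric] power2_eq_square sum_product ..
  also have "\<dots> = (\<Sum>i\<in>S. \<Sum>j\<in>S. measure_pmf.expectation P (\<lambda>f. c i (f i) * c j (f j)))"
    by (simp add: Bochner_Integration.integral_sum)
  also have "\<dots> = (\<Sum>i\<in>S. \<Sum>j\<in>S. if j = i then p i * (1 - p i) else 0)"
  proof (intro sum.cong refl)
    fix i j assume ij: "i \<in> S" "j \<in> S"
    have "measure_pmf.expectation P (\<lambda>f. c i (f i) * c i (f i)) = p i * (1 - p i)"
      using ij A by (subst single[of i "\<lambda>b. c i b * c i b"]) (auto simp: c_def algebra_simps)
    then show "measure_pmf.expectation P (\<lambda>f. c i (f i) * c j (f j))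
        = (if j = i then p i * (1 - p i) else 0)"
      using orth[of i j] ij by auto
  qed
  also have "\<dots> = (\<Sum>i\<in>S. p i * (1 - p i))"
    using finS by simp
  also have "\<dots> \<le> (\<Sum>e\<in>S. p e)"
    using p A by (intro sum_mono) (auto intro!: mult_left_le)
  finally show "measure_pmf.expectation P (\<lambda>f. (real (card {e \<in> S. f e}) - (\<Sum>e\<in>S. p e))\<^sup>2) \<le> (\<Sum>e\<in>S. p e)" .
qed

section \<open>A deterministic bound on the squared logarithmic deviation\<close>

text \<open>
  Below \<open>l / 4\<close> the crude bound \<open>(ln l)\<^sup>2\<close> is paid for by the deviation of \<open>d\<close> from \<open>m\<close>,
  which keeps Chebyshev's inequality out of the probabilistic part.
\<close>

lemma ln_deviation_sq_le:
  fixes d l m :: real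
  assumes l: "1 \<le> l" and m: "l / 2 \<le> m" and d: "0 \<le> d"
  shows "(ln (max d 1) - ln l)\<^sup>2
       \<le> 4 * (d + 1) / l + (ln 4)\<^sup>2 + 16 * (ln l)\<^sup>2 / l\<^sup>2 * (d - m)\<^sup>2"
proof (cases "d < l / 4")
  case True
  have "ln (max d 1) \<le> ln l" "0 \<le> ln (max d 1)"
    using True l by auto
  then have "(ln (max d 1) - ln l)\<^sup>2 \<le> (ln l)\<^sup>2"
    unfolding abs_le_square_iff[symmetric] by linarith
  also have "\<dots> \<le> (ln l)\<^sup>2 * (16 * (d - m)\<^sup>2 / l\<^sup>2)"
  proof -
    \<comment> \<open>Here \<open>d < l / 4\<close> and \<open>m \<ge> l / 2\<close>, so
      \<open>m - d\<close> exceeds \<open>l / 4\<close>; this gives the constant 16.\<close>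
    have "l\<^sup>2 \<le> (4 * (d - m))\<^sup>2"
      using True l m by (intro abs_le_square_iff[THEN iffD1]) auto
    then have "1 \<le> 16 * (d - m)\<^sup>2 / l\<^sup>2"
      unfolding power_mult_distrib using l by simp
    from mult_left_mono[OF this, of "(ln l)\<^sup>2"] show ?thesis
      by simp
  qed
  finally show ?thesis
    using d l by (auto intro!: add_increasing simp: mult_ac)
next
  case False
  define X where "X = max d 1 / l"
  have X: "1 / 4 \<le> X" "X \<le> (d + 1) / l"
    using False l d by (auto simp: X_def field_simps)
  have eq: "ln (max d 1) - ln l = ln X"
    using l by (simp add: X_def ln_div)
  \<comment> \<open>On [1/4, 1] the logarithm is at most \<open>ln 4\<close> in absolute value;
    above 1, passing to the square root gives \<open>ln X \<le> 2 * sqrt X\<close>, whose square is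
    linear in \<open>X\<close> and hence integrable against the mean degree.\<close>
  have "(ln X)\<^sup>2 \<le> 4 * X + (ln 4)\<^sup>2"
  proof (cases "X \<le> 1")
    case True
    have "ln (1 / 4) \<le> ln X" "ln X \<le> 0"
      using X True by (auto simp del: ln_div)
    then have "(ln X)\<^sup>2 \<le> (ln 4)\<^sup>2"
      by (intro abs_le_square_iff[THEN iffD1]) (auto simp: ln_div)
    then show ?thesis using X by auto
  next
    case False
    have "ln X = 2 * ln (sqrt X)"
      using X by (simp add: ln_sqrt)
    also have "\<dots> \<le> 2 * sqrt X"
      using ln_le_minus_one[of "sqrt X"] X by auto
    finally have "(ln X)\<^sup>2 \<le> (2 * sqrt X)\<^sup>2"
      using False by (intro power_mono) auto
    then show ?thesis
      using X by (simp add: power_mult_distrib add_increasing2)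
  qed
  also have "\<dots> \<le> 4 * (d + 1) / l + (ln 4)\<^sup>2"
    using mult_left_mono[OF X(2), of 4] by simp
  finally show ?thesis
    unfolding eq by (auto intro!: add_increasing2)
qed

section \<open>Two-sided bounds on the mean out-degree\<close>

definition mean_out_degree :: "nat \<Rightarrow> (nat \<Rightarrow> real) \<Rightarrow> (nat \<Rightarrow> real) \<Rightarrow> nat \<Rightarrow> real" where
  "mean_out_degree n wp wm v = (\<Sum>y\<in>{1..n} - {v}. edge_prob n wp wm v y)"

text \<open>Dropping the truncation at 1 and adding the diagonal term only increases the sum, which
  then factors; one \<open>M\<close> bounds \<open>wp v\<close>, the other the average
  in-weight.\<close>

lemma mean_out_degree_le:
  assumes "n \<ge> 1" "v \<in> {1..n}" "\<And>x. x \<in> {1..n} \<Longrightarrow> 0 < wm x"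
    and wp: "0 \<le> wp v" "wp v \<le> M" and sum: "(\<Sum>y\<in>{1..n}. wm y) \<le> M * real n"
  shows "mean_out_degree n wp wm v \<le> M\<^sup>2 * ln (real n)"
proof -
  have "mean_out_degree n wp wm v \<le> (\<Sum>y\<in>{1..n} - {v}. wp v * wm y * (ln (real n) / real n))"
    unfolding mean_out_degree_def edge_prob_def by (intro sum_mono) auto
  also have "\<dots> \<le> (\<Sum>y\<in>{1..n}. wp v * wm y * (ln (real n) / real n))"
    using assms by (intro sum_mono2) (auto intro!: mult_nonneg_nonneg divide_nonneg_nonneg intro: less_imp_le)
  also have "\<dots> = wp v * (\<Sum>y\<in>{1..n}. wm y) * (ln (real n) / real n)"
    by (simp add: sum_distrib_left sum_distrib_right sum_divide_distrib)
  also have "\<dots> \<le> M * (M * real n) * (ln (real n) / real n)"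
    using assms by (intro mult_mono sum) (auto intro!: sum_nonneg intro: less_imp_le)
  finally show ?thesis
    using assms by (simp add: power2_eq_square)
qed

text \<open>The untruncated sum \<open>a\<close> is at least \<open>ln n\<close>. Truncation loses
  at most the sum of the squares \<open>(a y)\<^sup>2\<close>, which the second moment of
  \<open>wm\<close> controls, and the excluded self-loop loses at most 1.\<close>

lemma le_mean_out_degree:
  assumes n: "n \<ge> 1" and v: "v \<in> {1..n}" and wm: "\<And>x. x \<in> {1..n} \<Longrightarrow> 0 < wm x"
    and wp: "1 \<le> wp v" "wp v \<le> M" and sum: "real n \<le> (\<Sum>y\<in>{1..n}. wm y)"
    and sq: "(\<Sum>y\<in>{1..n}. (wm y)\<^sup>2) \<le> B * real n"
  shows "ln (real n) - 1 - M\<^sup>2 * B * ((ln (real n))\<^sup>2 / real n) \<le> mean_out_degree n wp wm v"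
proof -
  define a where "a = (\<lambda>y. wp v * wm y * (ln (real n) / real n))"
  have l: "0 \<le> ln (real n)" using n by simp
  have "ln (real n) \<le> (\<Sum>y\<in>{1..n}. a y)"
  proof -
    have "1 * real n * (ln (real n) / real n) \<le> wp v * (\<Sum>y\<in>{1..n}. wm y) * (ln (real n) / real n)"
      using n l wp sum by (intro mult_mono) auto
    then show ?thesis
      using n by (simp add: a_def sum_distrib_left sum_distrib_right sum_divide_distrib)
  qed
  moreover have "(\<Sum>y\<in>{1..n}. (a y)\<^sup>2) \<le> M\<^sup>2 * B * ((ln (real n))\<^sup>2 / real n)"
  proof -
    have "(\<Sum>y\<in>{1..n}. (a y)\<^sup>2) = (wp v)\<^sup>2 * (\<Sum>y\<in>{1..n}. (wm y)\<^sup>2) * (ln (real n) / real n)\<^sup>2"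
      by (simp add: a_def power_mult_distrib power_divide sum_distrib_left sum_distrib_right sum_divide_distrib)
    also have "\<dots> \<le> M\<^sup>2 * (B * real n) * (ln (real n) / real n)\<^sup>2"
      using wp order_trans[OF sum_nonneg sq]
      by (intro mult_right_mono mult_mono sq power_mono) (auto intro: sum_nonneg)
    also have "\<dots> = M\<^sup>2 * B * ((ln (real n))\<^sup>2 / real n)"
      using n by (simp add: power2_eq_square)
    finally show ?thesis .
  qed
  moreover have "(\<Sum>y\<in>{1..n}. a y - (a y)\<^sup>2) \<le> (\<Sum>y\<in>{1..n}. edge_prob n wp wm v y)"
  proof (intro sum_mono)
    fix y
    \<comment> \<open>Completing the square gives \<open>a y\<close> minus its square at most 1/4,
      hence below 1; it is below \<open>a y\<close> trivially.\<close>
    have "a y - (a y)\<^sup>2 \<le> min (a y) 1"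
      using zero_le_power2[of "a y - 1/2"] by (auto simp: power2_eq_square algebra_simps min_def)
    then show "a y - (a y)\<^sup>2 \<le> edge_prob n wp wm v y"
      by (simp add: edge_prob_def a_def)
  qed
  moreover have "(\<Sum>y\<in>{1..n}. edge_prob n wp wm v y)
      = edge_prob n wp wm v v + mean_out_degree n wp wm v"
    unfolding mean_out_degree_def using v by (intro sum.remove) auto
  moreover have "edge_prob n wp wm v v \<le> 1"
    by (simp add: edge_prob_def)
  ultimately show ?thesis
    by (simp add: sum_subtractf)
qed

section \<open>Moments of the out-degree in the random digraph\<close>

lemma finite_possible_edges: "finite (possible_edges n)"
  by (rule finite_subset[of _ "{1..n} \<times> {1..n}"]) (auto simp: possible_edges_def)

lemma finite_set_chung_lu_digraph: "finite (set_pmf (chung_lu_digraph n wp wm))"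
  unfolding chung_lu_digraph_def
  by (simp add: finite_set_Pi_bool_pmf finite_possible_edges)

text \<open>The out-arcs of \<open>v\<close> are exactly the present edges among the pairs
  \<open>(v, y)\<close> with \<open>y \<noteq> v\<close>, so the out-degree is a count of
  independent indicators.\<close>

lemma
  assumes n: "n \<ge> 1" and v: "v \<in> {1..n}"
    and w: "\<And>x. x \<in> {1..n} \<Longrightarrow> 0 \<le> wp x \<and> 0 \<le> wm x"
  defines "P \<equiv> chung_lu_digraph n wp wm"
  shows expectation_out_degree:
      "measure_pmf.expectation P (\<lambda>G. real (out_degree (with_proj G) v)) = mean_out_degree n wp wm v"
    and variance_out_degree_le:
      "measure_pmf.expectation P (\<lambda>G. (real (out_degree (with_proj G) v) - mean_out_degree n wp wm v)\<^sup>2)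
         \<le> mean_out_degree n wp wm v"
proof -
  let ?S = "Pair v ` ({1..n} - {v})"
  let ?p = "\<lambda>e. edge_prob n wp wm (fst e) (snd e)"
  have S: "?S \<subseteq> possible_edges n"
    using v by (auto simp: possible_edges_def)
  have p: "0 \<le> ?p e \<and> ?p e \<le> 1" if "e \<in> possible_edges n" for e
    using that n w by (auto simp: edge_prob_def possible_edges_def)
  have deg: "out_degree (with_proj \<lparr>pverts = {1..n}, parcs = {e \<in> possible_edges n. f e}\<rparr>) v
      = card {e \<in> ?S. f e}" for f
    unfolding out_degree_def out_arcs_def
    using v by (intro arg_cong[where f = card]) (auto simp: possible_edges_def)
  have mean: "mean_out_degree n wp wm v = (\<Sum>e\<in>?S. ?p e)"
    unfolding mean_out_degree_def by (subst sum.reindex) (auto simp: inj_on_def)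
  have P: "measure_pmf.expectation P h = measure_pmf.expectation
      (Pi_pmf (possible_edges n) False (\<lambda>e. bernoulli_pmf (?p e)))
      (\<lambda>f. h \<lparr>pverts = {1..n}, parcs = {e \<in> possible_edges n. f e}\<rparr>)"
    for h :: "nat pair_pre_digraph \<Rightarrow> real"
    unfolding P_def chung_lu_digraph_def by (simp add: case_prod_unfold)
  show "measure_pmf.expectation P (\<lambda>G. real (out_degree (with_proj G) v)) = mean_out_degree n wp wm v"
    unfolding P deg mean
    by (rule expectation_card_Pi_bernoulli[OF finite_possible_edges S p])
  show "measure_pmf.expectation P (\<lambda>G. (real (out_degree (with_proj G) v) - mean_out_degree n wp wm v)\<^sup>2)
         \<le> mean_out_degree n wp wm v"
    unfolding P deg mean
    by (rule variance_card_Pi_bernoulli_le[OF finite_possible_edges S p])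
qed

text \<open>Integrates the pointwise bound: the linear term sees the mean degree and the quadratic
  term the variance, both of order \<open>l\<close>. The bound obtained depends on neither
  \<open>n\<close> nor \<open>v\<close>.\<close>

lemma expectation_log_out_degree_deviation_le:
  assumes n: "n \<ge> 1" and v: "v \<in> {1..n}"
    and w: "\<And>x. x \<in> {1..n} \<Longrightarrow> 0 \<le> wp x \<and> 0 \<le> wm x"
  defines "l \<equiv> ln (real n)"
  assumes l: "1 \<le> l" "(ln l)\<^sup>2 \<le> l"
    and m: "l / 2 \<le> mean_out_degree n wp wm v" "mean_out_degree n wp wm v \<le> C * l"
  shows "measure_pmf.expectation (chung_lu_digraph n wp wm) (\<lambda>G. (log_out_degree G v - ln l)\<^sup>2)
     \<le> 4 * (C + 1) + (ln 4)\<^sup>2 + 16 * C"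
proof -
  let ?P = "chung_lu_digraph n wp wm"
  let ?D = "\<lambda>G. real (out_degree (with_proj G) v)"
  let ?m = "mean_out_degree n wp wm v"
  note int [simp] = integrable_measure_pmf_finite[OF finite_set_chung_lu_digraph]
  have C: "0 \<le> C"
    using order_trans[OF m] l by (simp add: field_simps)
  have "measure_pmf.expectation ?P (\<lambda>G. (log_out_degree G v - ln l)\<^sup>2)
      \<le> measure_pmf.expectation ?P
          (\<lambda>G. 4 * (?D G + 1) / l + (ln 4)\<^sup>2 + 16 * (ln l)\<^sup>2 / l\<^sup>2 * (?D G - ?m)\<^sup>2)"
  proof (intro integral_mono int)
    fix G
    show "(log_out_degree G v - ln l)\<^sup>2
        \<le> 4 * (?D G + 1) / l + (ln 4)\<^sup>2 + 16 * (ln l)\<^sup>2 / l\<^sup>2 * (?D G - ?m)\<^sup>2"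
      using ln_deviation_sq_le[OF l(1) m(1), of "?D G"]
      by (simp add: log_out_degree_def of_nat_max)
  qed
  also have "\<dots> = 4 * (?m + 1) / l + (ln 4)\<^sup>2
      + 16 * (ln l)\<^sup>2 / l\<^sup>2 * measure_pmf.expectation ?P (\<lambda>G. (?D G - ?m)\<^sup>2)"
    using expectation_out_degree[where wp = wp and wm = wm, OF n v w] by simp
  \<comment> \<open>Uses \<open>1 \<le> l\<close> in the first term. In the last,
    \<open>(ln l)\<^sup>2 \<le> l\<close> and variance at most \<open>C * l\<close> exactly balance
    the factor \<open>l\<^sup>2\<close> in the denominator.\<close>
  also have "\<dots> \<le> 4 * (C * l + l) / l + (ln 4)\<^sup>2 + 16 * l / l\<^sup>2 * (C * l)"
    using l m C variance_out_degree_le[where wp = wp and wm = wm, OF n v w]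
    by (intro add_mono mult_mono divide_right_mono) auto
  also have "\<dots> = 4 * (C + 1) + (ln 4)\<^sup>2 + 16 * C"
    using l by (simp add: field_simps power2_eq_square)
  finally show ?thesis .
qed

section \<open>From vertexwise bounds to the entropy and the variance\<close>

text \<open>The mean square distance of the log-degree from \<open>c\<close> splits into its
  variance, which is \<open>sigma_sq\<close>, plus the squared distance of its mean from
  \<open>c\<close>. Both parts are nonnegative, so \<open>K\<close> bounds each of them.\<close>

lemma entropy_sigma_bounds:
  assumes n: "n \<ge> 1" and wm: "\<And>x. x \<in> {1..n} \<Longrightarrow> 0 < wm x"
    and K: "\<And>v. v \<in> {1..n} \<Longrightarrow>
      measure_pmf.expectation (chung_lu_digraph n wp wm) (\<lambda>G. (log_out_degree G v - c)\<^sup>2) \<le> K"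
  shows "(entropy_H n wp wm - c)\<^sup>2 \<le> K" and "0 \<le> sigma_sq n wp wm" and "sigma_sq n wp wm \<le> K"
proof -
  have supp: "set_pmf (mu_in n wm) \<subseteq> {1..n}"
    using pmf_mu_in[OF n wm] by (auto simp: set_pmf_iff split: if_splits)
  then have fin: "finite (set_pmf (mu_in n wm))"
    using finite_subset by blast
  define M where "M = pair_pmf (chung_lu_digraph n wp wm) (mu_in n wm)"
  define Z where "Z = (\<lambda>(G, v). log_out_degree G v)"
  have "finite (set_pmf M)"
    unfolding M_def using fin finite_set_chung_lu_digraph by auto
  note int [simp] = integrable_measure_pmf_finite[OF this]
  have H: "entropy_H n wp wm = measure_pmf.expectation M Z"
    by (simp add: entropy_H_def joint_expectation_def M_def Z_def)
  have "sigma_sq n wp wm = measure_pmf.expectation M (\<lambda>x. (Z x)\<^sup>2) - (measure_pmf.expectation M Z)\<^sup>2"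
    by (simp add: sigma_sq_def H joint_expectation_def M_def Z_def case_prod_unfold)
  also have var: "\<dots> = measure_pmf.variance M Z"
    by (rule measure_pmf.variance_eq[symmetric]) auto
  finally have sigma: "sigma_sq n wp wm = measure_pmf.variance M Z" .
  show nonneg: "0 \<le> sigma_sq n wp wm"
    unfolding sigma by (rule measure_pmf.variance_positive)
  have "measure_pmf.expectation M (\<lambda>x. (Z x - c)\<^sup>2) \<le> K"
  proof -
    have "measure_pmf.expectation M (\<lambda>(G, v). (log_out_degree G v - c)\<^sup>2) \<le> K"
      unfolding M_def using K supp
      by (intro expectation_pair_pmf_le finite_set_chung_lu_digraph fin) auto
    then show ?thesis
      by (simp add: Z_def case_prod_unfold)
  qed
  moreover have "measure_pmf.expectation M (\<lambda>x. (Z x - c)\<^sup>2)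
      = sigma_sq n wp wm + (entropy_H n wp wm - c)\<^sup>2"
    unfolding sigma H var[symmetric] by (simp add: power2_diff)
  ultimately show "(entropy_H n wp wm - c)\<^sup>2 \<le> K" "sigma_sq n wp wm \<le> K"
    using nonneg by (auto intro: order_trans[rotated])
qed

section \<open>Assembly of the asymptotics\<close>

theorem proposition1p2:
  fixes wp wm :: "nat \<Rightarrow> nat \<Rightarrow> real"
    and M0 M1 M2 \<eta> :: real
  assumes "M0 > 1" and "M1 > 1" and "M2 > 0" and "0 < \<eta>" and "\<eta> < 1"
    and "\<And>n. n \<ge> 2 \<Longrightarrow> chung_lu_weights n (wp n) (wm n)"
    and "\<And>n x. n \<ge> 2 \<Longrightarrow> x \<in> {1..n} \<Longrightarrow> M0 \<le> wp n x \<and> wp n x \<le> M1"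
    and "\<And>n. n \<ge> 2 \<Longrightarrow> (\<Sum>x\<in>{1..n}. wm n x powr (2 + \<eta>)) \<le> M2 * real n"
  shows "(\<lambda>n. entropy_H n (wp n) (wm n)) \<sim>[at_top] (\<lambda>n. ln (ln (real n)))
       \<and> (\<lambda>n. sigma_sq n (wp n) (wm n)) \<in> O[at_top](\<lambda>n. ln (ln (real n)))"
proof -
  \<comment> \<open>\<open>B\<close> is the coefficient of the truncation loss, with
    \<open>1 + M2\<close> bounding the average of the squared in-weights. \<open>K\<close> is the
    deviation bound for \<open>C = M1\<^sup>2\<close>, the constant of the upper bound on the mean
    degree.\<close>
  define B where "B = M1\<^sup>2 * (1 + M2)"
  define K where "K = 4 * (M1\<^sup>2 + 1) + (ln 4)\<^sup>2 + 16 * M1\<^sup>2"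
  have B: "0 < B" using assms by (simp add: B_def add_pos_pos)
  \<comment> \<open>For such \<open>n\<close> the losses in the lower bound on the mean degree take
    at most half of \<open>ln n\<close>.\<close>
  have "\<forall>\<^sub>F n :: nat in at_top. 1 + B * ((ln (real n))\<^sup>2 / real n) \<le> ln (real n) / 2"
    using B by real_asymp
  moreover have "\<forall>\<^sub>F n :: nat in at_top. 1 \<le> ln (real n)"
    by real_asymp
  moreover have "\<forall>\<^sub>F n :: nat in at_top. (ln (ln (real n)))\<^sup>2 \<le> ln (real n)"
    by real_asymp
  moreover have "\<forall>\<^sub>F n :: nat in at_top. n \<ge> 2"
    by (rule eventually_ge_at_top)
  ultimately have ev: "\<forall>\<^sub>F n in at_top. (entropy_H n (wp n) (wm n) - ln (ln (real n)))\<^sup>2 \<le> K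
      \<and> \<bar>sigma_sq n (wp n) (wm n)\<bar> \<le> K"
  proof eventually_elim
    case (elim n)
    note large = elim(1) and l = elim(2,3) and n = \<open>n \<ge> 2\<close>
    have n1: "n \<ge> 1" using n by simp
    have wm: "0 < wm n x" if "x \<in> {1..n}" for x
      using assms(6)[OF n] that by (auto simp: chung_lu_weights_def)
    have wp: "1 \<le> wp n x" "wp n x \<le> M1" if "x \<in> {1..n}" for x
      using assms(7)[OF n that] assms(1) by auto
    have w: "0 \<le> wp n x \<and> 0 \<le> wm n x" if "x \<in> {1..n}" for x
      using wm[OF that] wp[OF that] by auto
    have total: "(\<Sum>x\<in>{1..n}. wm n x) = (\<Sum>x\<in>{1..n}. wp n x)"
      using assms(6)[OF n] by (simp add: chung_lu_weights_def)
    have sum_le: "(\<Sum>x\<in>{1..n}. wm n x) \<le> M1 * real n"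
      unfolding total using sum_bounded_above[of "{1..n}" "wp n" M1] wp by (simp add: mult.commute)
    have sum_ge: "real n \<le> (\<Sum>x\<in>{1..n}. wm n x)"
      unfolding total using sum_bounded_below[of "{1..n}" 1 "wp n"] wp by simp
    have sq: "(\<Sum>x\<in>{1..n}. (wm n x)\<^sup>2) \<le> (1 + M2) * real n"
    proof -
      \<comment> \<open>The moment of order \<open>2 + \<eta>\<close> dominates the square for
        weights above 1; smaller weights contribute at most 1 each.\<close>
      have "(wm n x)\<^sup>2 \<le> 1 + wm n x powr (2 + \<eta>)" if "x \<in> {1..n}" for x
      proof (cases "wm n x \<le> 1")
        case True
        then have "(wm n x)\<^sup>2 \<le> 1" using wm[OF that] by (simp add: power_le_one)
        then show ?thesis by (simp add: add_increasing2)
      next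
        case False
        then have "wm n x powr 2 \<le> wm n x powr (2 + \<eta>)"
          using assms(4) by (intro powr_mono) auto
        then show ?thesis using wm[OF that] by simp
      qed
      then have "(\<Sum>x\<in>{1..n}. (wm n x)\<^sup>2) \<le> (\<Sum>x\<in>{1..n}. 1 + wm n x powr (2 + \<eta>))"
        by (intro sum_mono)
      also have "\<dots> \<le> real n + M2 * real n"
        using assms(8)[OF n] by (simp add: sum.distrib)
      finally show ?thesis by (simp add: algebra_simps)
    qed
    have dev: "measure_pmf.expectation (chung_lu_digraph n (wp n) (wm n))
        (\<lambda>G. (log_out_degree G v - ln (ln (real n)))\<^sup>2) \<le> K" if v: "v \<in> {1..n}" for v
      unfolding K_def
    proof (rule expectation_log_out_degree_deviation_le[OF n1 v w l])
      show "ln (real n) / 2 \<le> mean_out_degree n (wp n) (wm n) v"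
        using le_mean_out_degree[where wp = "wp n" and wm = "wm n", OF n1 v wm wp[OF v] sum_ge sq] large
        by (simp add: B_def)
      show "mean_out_degree n (wp n) (wm n) v \<le> M1\<^sup>2 * ln (real n)"
        using mean_out_degree_le[where wp = "wp n" and wm = "wm n", OF n1 v wm _ wp(2)[OF v] sum_le] w[OF v]
        by simp
    qed
    show ?case
      using entropy_sigma_bounds[where wp = "wp n" and wm = "wm n", OF n1 wm dev] by auto
  qed
  \<comment> \<open>Since \<open>ln (ln n)\<close> tends to infinity, the bounded error in the
    entropy becomes negligible, and a bounded variance is in particular
    \<open>O(ln (ln n))\<close>.\<close>
  have one: "(\<lambda>_. 1) \<in> o[at_top](\<lambda>n :: nat. ln (ln (real n)))"
    by real_asymp
  have "(\<lambda>n. entropy_H n (wp n) (wm n) - ln (ln (real n))) \<in> O[at_top](\<lambda>_. 1)"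
  proof (rule bigoI[of _ "sqrt K"], use ev in eventually_elim)
    case (elim n)
    then show ?case
      using real_sqrt_le_mono[of "(entropy_H n (wp n) (wm n) - ln (ln (real n)))\<^sup>2" K] by simp
  qed
  then have "(\<lambda>n. entropy_H n (wp n) (wm n)) \<sim>[at_top] (\<lambda>n. ln (ln (real n)))"
    using one by (intro smallo_imp_asymp_equiv) (rule landau_o.big_small_trans)
  moreover have "(\<lambda>n. sigma_sq n (wp n) (wm n)) \<in> O[at_top](\<lambda>_. 1)"
    by (rule bigoI[of _ K], use ev in eventually_elim) auto
  then have "(\<lambda>n. sigma_sq n (wp n) (wm n)) \<in> O[at_top](\<lambda>n. ln (ln (real n)))"
    using landau_o.big.trans[OF _ landau_o.small_imp_big[OF one]] by blast
  ultimately show ?thesis by blast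
qed

end
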